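(* Let $n$ be a positive integer with $n \neq 1$. Let $K=\mathbb{Q}(\sqrt{-n})$, let $d_K$ be the discriminant of $K$, and let $f$ be the conductor of the order $\mathbb{Z}[\sqrt{-n}]$ in $K$. Let $p$ be a prime number such that there exists $z\in \mathbb{Z}[\sqrt{-n}]$ with $|z|^2=p$, and such that $\left(\frac{d_K}{p}\right)=1$ and $\gcd(p,f)=1$. Then for every positive integer $k$, $$\#\{z\in \mathbb{Z}[\sqrt{-n}] \mid |z|^2=p^k\}=2(k+1).$$
   Context: $\mathbb{Z}[\sqrt{-n}]=\{x+y\sqrt{-n}\mid x,y\in\mathbb{Z}\}\subset\mathbb{C}$, so $|x+y\sqrt{-n}|^2=x^2+ny^2$. Write $K=\mathbb{Q}(\sqrt{-n})=\mathbb{Q}(\sqrt{-d})$ with $d$ a square-free positive integer. The discriminant is $d_K=-4d$ if $-d\equiv 2,3\pmod 4$ and $d_K=-d$ if $-d\equiv 1\pmod 4$. The conductor of the order $\mathbb{Z}[\sqrt{-n}]$ is its index $f=[\mathcal{O}_K:\mathbb{Z}[\sqrt{-n}]]$ in the ring of integers $\mathcal{O}_K$ of $K$; it is the positive integer satisfying $-4n=f^2d_K$. The symbol $\left(\frac{\cdot}{p}\right)$ is the Legendre symbol; for $p=2$ the condition $\left(\frac{d_K}{2}\right)=1$ is read as $d_K\equiv 1\pmod 8$. *)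

theory Defs
  imports "HOL-Number_Theory.Number_Theory" "HOL-Computational_Algebra.Computational_Algebra"
begin

definition quad_order :: "nat \<Rightarrow> complex set" where
  "quad_order n = {of_int x + of_int y * csqrt (- of_nat n) | x y :: int. True}"

definition quad_field :: "nat \<Rightarrow> complex set" where
  "quad_field n = {of_rat x + of_rat y * csqrt (- of_nat n) | x y :: rat. True}"

definition ring_of_integers :: "complex set \<Rightarrow> complex set" where
  "ring_of_integers K = {z \<in> K. algebraic_int z}"

(* Meaningful for imaginary quadratic K only; existence and uniqueness of d are
   quad_radicand_quad_field below. *)
definition quad_radicand :: "complex set \<Rightarrow> nat" where
  "quad_radicand K = (THE d. d > 0 \<and> squarefree d \<and> quad_field d = K)"

definition quad_discriminant :: "complex set \<Rightarrow> int" where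
  "quad_discriminant K =
     (let d = int (quad_radicand K) in if [- d = 1] (mod 4) then - d else - 4 * d)"

(* The index of the additive group of R in that of the maximal order of K. *)
definition conductor :: "complex set \<Rightarrow> complex set \<Rightarrow> nat" where
  "conductor K R =
     card (ring_of_integers K //
       {(a, b). a \<in> ring_of_integers K \<and> b \<in> ring_of_integers K \<and> a - b \<in> R})"

lemma csqrt_minus_of_nat: "csqrt (- of_nat n) = \<i> * of_real (sqrt (of_nat n))"
  by (subst csqrt_of_real_nonpos) auto

lemma of_rat_complex_conv: "(of_rat q :: complex) = of_real (of_rat q)"
  by (induct q) (simp add: of_rat_rat)

lemma squarefree_part_eqI:
  fixes m n u v :: nat
  assumes eq: "m * v ^ 2 = n * u ^ 2" and "m > 0" "v > 0"
  shows "squarefree_part m = squarefree_part n"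
proof (rule multiplicity_eq_nat)
  have nz: "n > 0" "u > 0" using assms by (auto intro!: Nat.gr0I)
  fix r :: nat assume r: "prime r"
  have "multiplicity r m + 2 * multiplicity r v = multiplicity r (m * v ^ 2)"
    using r assms(2,3) by (simp add: prime_elem_multiplicity_mult_distrib
        prime_elem_multiplicity_power_distrib)
  also have "\<dots> = multiplicity r n + 2 * multiplicity r u"
    unfolding eq using r nz by (simp add: prime_elem_multiplicity_mult_distrib
        prime_elem_multiplicity_power_distrib)
  finally have "multiplicity r m mod 2 = multiplicity r n mod 2" by presburger
  thus "multiplicity r (squarefree_part m) = multiplicity r (squarefree_part n)"
    using r by (simp add: prime_multiplicity_squarefree_part)
qed (auto intro!: Nat.gr0I)

lemma squarefree_part_squarefree:
  fixes d :: nat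
  assumes "squarefree d"
  shows "squarefree_part d = d"
proof (rule multiplicity_eq_nat)
  fix r :: nat assume r: "prime r"
  have "multiplicity r d \<le> 1"
    using assms r by (cases "d = 0") (auto simp: squarefree_factorial_semiring'')
  thus "multiplicity r (squarefree_part d) = multiplicity r d"
    using r by (simp add: prime_multiplicity_squarefree_part)
qed (use assms in \<open>auto intro!: Nat.gr0I\<close>)

lemma quad_field_squarefree_part:
  assumes "n > 0"
  shows "quad_field (squarefree_part n) = quad_field n"
proof -
  define s q where "s = squarefree_part n" and "q = square_part n"
  have q0: "q > 0" using assms by (auto simp: q_def intro!: Nat.gr0I)
  have n: "n = s * q ^ 2" unfolding s_def q_def by (rule squarefree_decompose)
  have e: "csqrt (- of_nat n) = of_rat (of_nat q) * csqrt (- of_nat s)"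
    unfolding csqrt_minus_of_nat by (simp add: n real_sqrt_mult)
  have "quad_field s = quad_field n"
  proof (intro equalityI subsetI)
    fix z assume "z \<in> quad_field s"
    then obtain x y where z: "z = of_rat x + of_rat y * csqrt (- of_nat s)"
      by (auto simp: quad_field_def)
    have "z = of_rat x + of_rat (y / of_nat q) * csqrt (- of_nat n)"
      unfolding e z using q0 by (simp add: of_rat_divide)
    thus "z \<in> quad_field n" by (auto simp: quad_field_def)
  next
    fix z assume "z \<in> quad_field n"
    then obtain x y where z: "z = of_rat x + of_rat y * csqrt (- of_nat n)"
      by (auto simp: quad_field_def)
    have "z = of_rat x + of_rat (y * of_nat q) * csqrt (- of_nat s)"
      unfolding e z by (simp add: of_rat_mult)
    thus "z \<in> quad_field s" unfolding quad_field_def by blast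
  qed
  thus ?thesis by (simp add: s_def)
qed

lemma quad_radicand_quad_field:
  assumes "n > 0"
  shows "quad_radicand (quad_field n) = squarefree_part n"
  unfolding quad_radicand_def
proof (rule the_equality)
  show "0 < squarefree_part n \<and> squarefree (squarefree_part n) \<and>
        quad_field (squarefree_part n) = quad_field n"
    using quad_field_squarefree_part[OF assms] by (auto intro!: Nat.gr0I)
next
  fix d :: nat assume d: "d > 0 \<and> squarefree d \<and> quad_field d = quad_field n"
  have "csqrt (- of_nat d) = of_rat 0 + of_rat 1 * csqrt (- of_nat d)" by simp
  hence "csqrt (- of_nat d) \<in> quad_field d" unfolding quad_field_def by blast
  then obtain a b where "csqrt (- of_nat d) = of_rat a + of_rat b * csqrt (- of_nat n)"
    using d unfolding quad_field_def[of n] by blast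
  hence "Im (csqrt (- of_nat d)) = Im (of_rat a + of_rat b * csqrt (- of_nat n))" by simp
  hence "sqrt (real d) = of_rat b * sqrt (real n)"
    unfolding csqrt_minus_of_nat of_rat_complex_conv by simp
  hence "sqrt (real d) ^ 2 = (of_rat b * sqrt (real n)) ^ 2" by simp
  hence db: "real d = of_rat b ^ 2 * real n" by (simp add: power_mult_distrib)
  obtain u v where uv: "b = of_int u / of_int v" "v > 0"
    by (cases b) (auto simp: Fract_of_int_quotient)
  have "real d * real (nat v) ^ 2 = real n * real (nat \<bar>u\<bar>) ^ 2"
    unfolding db uv(1) using uv(2) by (simp add: of_rat_divide power_divide)
  hence "real (d * nat v ^ 2) = real (n * nat \<bar>u\<bar> ^ 2)" by simp
  hence "d * nat v ^ 2 = n * nat \<bar>u\<bar> ^ 2" by (simp only: of_nat_eq_iff)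
  hence "squarefree_part d = squarefree_part n"
    using d uv by (intro squarefree_part_eqI) auto
  moreover have "squarefree_part d = d"
    using d by (simp add: squarefree_part_squarefree)
  ultimately show "d = squarefree_part n" by simp
qed

end

theory Submission
  imports Defs
begin

text \<open>
  Put \<open>\<theta> = \<surd>(-n)\<close>, let \<open>\<pi> = a + b \<theta>\<close> be an element with
  \<open>\<bar>\<pi>\<bar>\<^sup>2 = a\<^sup>2 + n b\<^sup>2 = p\<close>, and write \<open>\<pi>'\<close> for its conjugate. The theorem holds
  because the elements of squared modulus \<open>p ^ k\<close> are exactly the products
  \<open>\<plusminus> \<pi>\<^sup>i \<pi>'\<^sup>(\<^sup>k\<^sup>-\<^sup>i\<^sup>)\<close> with \<open>i \<le> k\<close>, and these \<open>2 (k + 1)\<close> products are distinct.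

  The order \<open>\<int>[\<theta>]\<close> need not have unique factorization, so the shape of these elements cannot be
  read off from prime factorizations. But for an element of squared modulus \<open>p ^ (k + 1)\<close> a direct
  computation with coordinates shows that \<open>\<pi>\<close> or \<open>\<pi>'\<close> divides it
  (\<open>dvd_norm_cross_product\<close>, \<open>quad_order_split_factor\<close>), and induction reduces to the units,
  which are \<open>\<plusminus>1\<close> since \<open>n \<ge> 2\<close>.

  Two of the products can coincide only if \<open>\<pi>\<^sup>m = \<plusminus> \<pi>'\<^sup>m\<close> for some \<open>m > 0\<close>, that is, only if
  a coordinate of \<open>\<pi>\<^sup>m\<close> vanishes. But \<open>\<pi>\<^sup>2 = 2 a \<pi> - p\<close> gives \<open>\<pi>\<^sup>m \<equiv> (2a)\<^sup>m\<^sup>-\<^sup>1 \<pi>\<close> modulo \<open>p\<close>,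
  and \<open>p\<close> divides none of \<open>2\<close>, \<open>a\<close>, \<open>b\<close> as long as it does not divide \<open>n\<close>
  (\<open>quad_power_coordinates\<close>).

  It remains to see that \<open>p\<close> does not divide \<open>n\<close>. Since \<open>p = a\<^sup>2 + n b\<^sup>2\<close> with \<open>b \<noteq> 0\<close>, it could only
  do so for \<open>n = p\<close>; then \<open>K = \<rat>(\<surd>(-p))\<close>, in which \<open>p\<close> divides the discriminant, so
  that \<open>p\<close> is ramified and not split.
\<close>

section \<open>Elements of the order and their coordinates\<close>

definition quad_elt :: "nat \<Rightarrow> int \<Rightarrow> int \<Rightarrow> complex" where
  "quad_elt n x y = of_int x + of_int y * csqrt (- of_nat n)"

lemma quad_order_iff: "z \<in> quad_order n \<longleftrightarrow> (\<exists>x y. z = quad_elt n x y)"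
  by (auto simp: quad_order_def quad_elt_def)

lemma Re_quad_elt [simp]: "Re (quad_elt n x y) = of_int x"
  and Im_quad_elt [simp]: "Im (quad_elt n x y) = of_int y * sqrt (real n)"
  by (simp_all add: quad_elt_def csqrt_minus_of_nat)

lemma cnj_quad_elt: "cnj (quad_elt n x y) = quad_elt n x (- y)"
  by (simp add: complex_eq_iff)

lemma uminus_quad_elt: "- quad_elt n x y = quad_elt n (- x) (- y)"
  by (simp add: complex_eq_iff)

lemma quad_elt_mult:
  "quad_elt n x y * quad_elt n u v = quad_elt n (x * u - int n * y * v) (x * v + y * u)"
  by (simp add: complex_eq_iff algebra_simps)

lemma cmod_quad_elt_power2:
  "(cmod (quad_elt n x y))\<^sup>2 = of_int (x\<^sup>2 + int n * y\<^sup>2)"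
  by (simp add: cmod_power2 power_mult_distrib)

lemma cmod_quad_elt_power2_eq_iff:
  "(cmod (quad_elt n x y))\<^sup>2 = real m \<longleftrightarrow> x\<^sup>2 + int n * y\<^sup>2 = int m"
  unfolding cmod_quad_elt_power2 by (metis of_int_eq_iff of_int_of_nat_eq)

lemma quad_order_mult: "z \<in> quad_order n \<Longrightarrow> w \<in> quad_order n \<Longrightarrow> z * w \<in> quad_order n"
  unfolding quad_order_iff by (metis quad_elt_mult)

lemma quad_order_cnj: "z \<in> quad_order n \<Longrightarrow> cnj z \<in> quad_order n"
  unfolding quad_order_iff by (metis cnj_quad_elt)

lemma quad_order_uminus: "z \<in> quad_order n \<Longrightarrow> - z \<in> quad_order n"
  unfolding quad_order_iff by (metis uminus_quad_elt)

lemma quad_order_one: "1 \<in> quad_order n"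
  unfolding quad_order_iff by (rule exI[of _ 1], rule exI[of _ 0]) (simp add: complex_eq_iff)

lemma quad_order_power: "z \<in> quad_order n \<Longrightarrow> z ^ i \<in> quad_order n"
  by (induction i) (auto intro: quad_order_one quad_order_mult)

section \<open>Primes represented by the norm form\<close>

locale norm_form_prime =
  fixes n p :: nat and a b :: int
  assumes n_ge_2: "n \<ge> 2"
    and prime_p: "prime p"
    and norm_eq: "a\<^sup>2 + int n * b\<^sup>2 = int p"
begin

lemma prime_int_p: "prime (int p)"
  using prime_p by simp

text \<open>Otherwise the prime \<open>p\<close> would be the square \<open>a\<^sup>2\<close>.\<close>

lemma b_nonzero: "b \<noteq> 0"
proof
  assume "b = 0"
  with norm_eq have "int p = a ^ 2" by simp
  with prime_int_p show False by (simp add: prime_power_iff)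
qed

lemma n_le_p: "n \<le> p"
proof -
  have "1 \<le> b\<^sup>2" using b_nonzero by (simp add: int_one_le_iff_zero_less)
  hence "int n * 1 \<le> int n * b\<^sup>2" by (intro mult_left_mono) auto
  also have "\<dots> \<le> int p" using norm_eq zero_le_power2[of a] by linarith
  finally show ?thesis by simp
qed

lemma dvd_imp_eq: "p dvd n \<Longrightarrow> n = p"
  using n_le_p n_ge_2 by (auto dest: dvd_imp_le)

end

locale unramified_norm_form_prime = norm_form_prime +
  assumes not_dvd_n: "\<not> p dvd n"
begin

text \<open>If \<open>p\<close> divided one coordinate of \<open>\<pi>\<close>, it would divide both, and \<open>p\<^sup>2\<close> would divide \<open>p\<close>.\<close>

lemma not_dvd_b: "\<not> int p dvd b"
proof
  assume b: "int p dvd b"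
  hence "int p dvd int p - int n * b\<^sup>2" by (simp add: power2_eq_square)
  also have "int p - int n * b\<^sup>2 = a\<^sup>2" using norm_eq by linarith
  finally have "int p dvd a\<^sup>2" .
  hence "int p dvd a" using prime_int_p prime_dvd_power by blast
  hence "(int p)\<^sup>2 dvd a\<^sup>2 + int n * b\<^sup>2"
    using b by (intro dvd_add dvd_mult) (auto intro: dvd_power_same)
  hence "int p ^ 2 dvd int p ^ 1" using norm_eq by simp
  thus False using prime_gt_1_nat[OF prime_p] by (subst (asm) dvd_power_iff) auto
qed

lemma not_dvd_a: "\<not> int p dvd a"
proof
  assume "int p dvd a"
  hence "int p dvd int p - a\<^sup>2" by (simp add: power2_eq_square)
  also have "int p - a\<^sup>2 = int n * b\<^sup>2" using norm_eq by linarith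
  finally have "int p dvd int n * b\<^sup>2" .
  hence "int p dvd int n \<or> int p dvd b"
    using prime_int_p by (metis prime_dvd_mult_iff prime_dvd_power)
  thus False using not_dvd_n not_dvd_b by simp
qed

text \<open>The prime \<open>2\<close> is of the form \<open>a\<^sup>2 + n b\<^sup>2\<close> with \<open>n \<ge> 2\<close> only for \<open>n = 2\<close>.\<close>

lemma not_dvd_2: "\<not> int p dvd 2"
proof
  assume "int p dvd 2"
  hence "p \<le> 2" using zdvd_imp_le[of "int p" 2] by simp
  hence "n = p" using n_le_p n_ge_2 by simp
  thus False using not_dvd_n by simp
qed

section \<open>Splitting off a factor\<close>

text \<open>
  The two factors are the second coordinates of \<open>\<pi>' z\<close> and \<open>\<pi> z\<close> for \<open>z = x + y \<theta>\<close>, up to sign;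
  modulo \<open>p\<close> one has \<open>a\<^sup>2 \<equiv> -n b\<^sup>2\<close>, so that their product is
  congruent to \<open>- b\<^sup>2 (x\<^sup>2 + n y\<^sup>2)\<close>.
\<close>

lemma dvd_norm_cross_product:
  assumes "int p dvd x\<^sup>2 + int n * y\<^sup>2"
  shows "int p dvd y * a - x * b \<or> int p dvd y * a + x * b"
proof -
  have "(y * a - x * b) * (y * a + x * b) = y\<^sup>2 * (a\<^sup>2 + int n * b\<^sup>2) - b\<^sup>2 * (x\<^sup>2 + int n * y\<^sup>2)"
    by (simp add: algebra_simps power2_eq_square)
  also have "int p dvd \<dots>" unfolding norm_eq using assms by (intro dvd_diff dvd_mult) auto
  finally show ?thesis using prime_int_p by (simp add: prime_dvd_mult_iff)
qed

text \<open>
  If \<open>p\<close> divides the second coordinate of \<open>\<pi>' z\<close>, it divides the first as well, because it divides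
  the norm \<open>p\<^sup>k\<^sup>+\<^sup>2\<close>; hence \<open>z = \<pi> w\<close> for \<open>w = \<pi>' z / p\<close>.
\<close>

lemma quad_order_divide:
  assumes norm: "x\<^sup>2 + int n * y\<^sup>2 = int p ^ Suc k" and dvd: "int p dvd y * a - x * b"
  shows "\<exists>w \<in> quad_order n. (cmod w)\<^sup>2 = real (p ^ k) \<and> quad_elt n x y = quad_elt n a b * w"
proof -
  have p0: "int p \<noteq> 0" using prime_int_p by auto
  have eq: "(x * a + int n * y * b)\<^sup>2 + int n * (y * a - x * b)\<^sup>2 = int p ^ Suc (Suc k)"
  proof -
    have "(x * a + int n * y * b)\<^sup>2 + int n * (y * a - x * b)\<^sup>2
        = (a\<^sup>2 + int n * b\<^sup>2) * (x\<^sup>2 + int n * y\<^sup>2)"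
      by (simp add: algebra_simps power2_eq_square)
    thus ?thesis unfolding norm norm_eq by simp
  qed
  have "int p dvd int p ^ Suc (Suc k) - int n * (y * a - x * b)\<^sup>2"
    using dvd by (intro dvd_diff dvd_mult) (auto simp: power2_eq_square)
  also have "\<dots> = (x * a + int n * y * b)\<^sup>2" unfolding eq[symmetric] by simp
  finally have "int p dvd x * a + int n * y * b" using prime_int_p prime_dvd_power by blast
  then obtain u where u: "x * a + int n * y * b = int p * u" by (elim dvdE)
  from dvd obtain v where v: "y * a - x * b = int p * v" by (elim dvdE)
  have "int p ^ 2 * (u\<^sup>2 + int n * v\<^sup>2) = int p ^ 2 * int p ^ k"
    using eq unfolding u v by (simp add: power2_eq_square algebra_simps)
  hence nw: "u\<^sup>2 + int n * v\<^sup>2 = int p ^ k" using p0 by simp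
  have px: "int p * (a * u - int n * b * v) = int p * x"
  proof -
    have "int p * (a * u - int n * b * v) = a * (int p * u) - int n * b * (int p * v)"
      by (simp add: algebra_simps)
    also have "\<dots> = x * (a\<^sup>2 + int n * b\<^sup>2)"
      unfolding u[symmetric] v[symmetric] by (simp add: algebra_simps power2_eq_square)
    finally show ?thesis unfolding norm_eq by (simp only: mult.commute)
  qed
  have x: "x = a * u - int n * b * v" by (rule mult_left_cancel[OF p0, THEN iffD1, OF px, symmetric])
  have py: "int p * (a * v + b * u) = int p * y"
  proof -
    have "int p * (a * v + b * u) = a * (int p * v) + b * (int p * u)"
      by (simp add: algebra_simps)
    also have "\<dots> = y * (a\<^sup>2 + int n * b\<^sup>2)"
      unfolding u[symmetric] v[symmetric] by (simp add: algebra_simps power2_eq_square)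
    finally show ?thesis unfolding norm_eq by (simp only: mult.commute)
  qed
  have y: "y = a * v + b * u" by (rule mult_left_cancel[OF p0, THEN iffD1, OF py, symmetric])
  have "quad_elt n x y = quad_elt n a b * quad_elt n u v"
    unfolding quad_elt_mult by (simp only: x y)
  moreover have "(cmod (quad_elt n u v))\<^sup>2 = real (p ^ k)"
    unfolding cmod_quad_elt_power2_eq_iff using nw by simp
  moreover have "quad_elt n u v \<in> quad_order n" by (auto simp: quad_order_iff)
  ultimately show ?thesis by blast
qed

text \<open>
  If instead \<open>p\<close> divides the second coordinate of \<open>\<pi> z\<close>, the preceding lemma applies to the
  conjugate of \<open>z\<close>.
\<close>

lemma quad_order_split_factor:
  assumes z: "z \<in> quad_order n" and norm: "(cmod z)\<^sup>2 = real (p ^ Suc k)"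
  shows "\<exists>w \<in> quad_order n. (cmod w)\<^sup>2 = real (p ^ k) \<and>
           (z = quad_elt n a b * w \<or> z = cnj (quad_elt n a b) * w)"
proof -
  from z obtain x y where z_eq: "z = quad_elt n x y" by (auto simp: quad_order_iff)
  have xy: "x\<^sup>2 + int n * y\<^sup>2 = int p ^ Suc k"
    using norm unfolding z_eq cmod_quad_elt_power2_eq_iff by simp
  hence "int p dvd x\<^sup>2 + int n * y\<^sup>2" by simp
  then consider "int p dvd y * a - x * b" | "int p dvd y * a + x * b"
    using dvd_norm_cross_product by blast
  thus ?thesis
  proof cases
    case 1
    thus ?thesis using quad_order_divide[OF xy] z_eq by blast
  next
    case 2
    hence "int p dvd - (y * a + x * b)" by (simp only: dvd_minus_iff)
    hence "int p dvd (- y) * a - x * b" by (simp add: algebra_simps)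
    moreover have "x\<^sup>2 + int n * (- y)\<^sup>2 = int p ^ Suc k" using xy by simp
    ultimately obtain w where w: "w \<in> quad_order n" "(cmod w)\<^sup>2 = real (p ^ k)"
        "quad_elt n x (- y) = quad_elt n a b * w"
      using quad_order_divide by blast
    have "z = cnj (quad_elt n x (- y))" by (simp add: z_eq cnj_quad_elt)
    also have "\<dots> = cnj (quad_elt n a b) * cnj w" unfolding w(3) by simp
    finally show ?thesis using w quad_order_cnj by (intro bexI[of _ "cnj w"]) auto
  qed
qed

lemma quad_order_unit:
  assumes z: "z \<in> quad_order n" and norm: "(cmod z)\<^sup>2 = 1"
  shows "z \<in> {1, - 1}"
proof -
  from z obtain x y where z_eq: "z = quad_elt n x y" by (auto simp: quad_order_iff)
  have xy: "x\<^sup>2 + int n * y\<^sup>2 = 1"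
    using norm cmod_quad_elt_power2_eq_iff[of n x y 1] unfolding z_eq by simp
  have y: "y = 0"
  proof (rule ccontr)
    assume "y \<noteq> 0"
    hence "1 \<le> y\<^sup>2" by (simp add: int_one_le_iff_zero_less)
    hence "int n * 1 \<le> int n * y\<^sup>2" by (intro mult_left_mono) auto
    thus False using xy zero_le_power2[of x] n_ge_2 by linarith
  qed
  hence "x = 1 \<or> x = - 1" using xy by (simp add: power2_eq_1_iff)
  thus ?thesis using y by (auto simp: z_eq complex_eq_iff)
qed

lemma prime_power_norm_form:
  assumes "z \<in> quad_order n" and "(cmod z)\<^sup>2 = real (p ^ k)"
  shows "\<exists>e \<in> {1, - 1}. \<exists>i \<le> k. z = e * quad_elt n a b ^ i * cnj (quad_elt n a b) ^ (k - i)"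
  using assms
proof (induction k arbitrary: z)
  case 0
  thus ?case using quad_order_unit[of z] by auto
next
  case (Suc k)
  obtain w where w: "w \<in> quad_order n" "(cmod w)\<^sup>2 = real (p ^ k)"
      and z: "z = quad_elt n a b * w \<or> z = cnj (quad_elt n a b) * w"
    using quad_order_split_factor[OF Suc.prems] by blast
  obtain e i where e: "e \<in> {1, - 1}" and i: "i \<le> k"
      and w_eq: "w = e * quad_elt n a b ^ i * cnj (quad_elt n a b) ^ (k - i)"
    using Suc.IH[OF w] by blast
  from z show ?case
  proof
    assume "z = quad_elt n a b * w"
    hence "z = e * quad_elt n a b ^ Suc i * cnj (quad_elt n a b) ^ (Suc k - Suc i)"
      by (simp add: w_eq)
    thus ?thesis using e i by (intro bexI[of _ e] exI[of _ "Suc i"] conjI) auto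
  next
    assume "z = cnj (quad_elt n a b) * w"
    hence "z = e * quad_elt n a b ^ i * cnj (quad_elt n a b) ^ (Suc k - i)"
      using i by (simp add: w_eq Suc_diff_le)
    thus ?thesis using e i by (intro bexI[of _ e] exI[of _ i] conjI) auto
  qed
qed

section \<open>The products are distinct\<close>

text \<open>
  The congruences \<open>u \<equiv> (2a)\<^sup>m a\<close> and \<open>v \<equiv> (2a)\<^sup>m b\<close> express \<open>\<pi>\<^sup>m\<^sup>+\<^sup>1 \<equiv> (2a)\<^sup>m \<pi>\<close> modulo \<open>p\<close>. In the
  induction step, \<open>a\<^sup>2 - n b\<^sup>2 = 2 a\<^sup>2 - p\<close>.
\<close>

lemma quad_power_coordinates:
  "\<exists>u v. quad_elt n a b ^ Suc m = quad_elt n u v \<and>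
         [u = (2 * a) ^ m * a] (mod int p) \<and> [v = (2 * a) ^ m * b] (mod int p)"
proof (induction m)
  case 0
  show ?case by (rule exI[of _ a], rule exI[of _ b]) simp
next
  case (Suc m)
  then obtain u v where uv: "quad_elt n a b ^ Suc m = quad_elt n u v"
      "[u = (2 * a) ^ m * a] (mod int p)" "[v = (2 * a) ^ m * b] (mod int p)"
    by blast
  have "quad_elt n a b ^ Suc (Suc m) = quad_elt n (a * u - int n * b * v) (a * v + b * u)"
    using uv(1) by (simp add: quad_elt_mult)
  moreover have "[a * u - int n * b * v = (2 * a) ^ Suc m * a] (mod int p)"
  proof -
    have "[a * u - int n * b * v = a * ((2 * a) ^ m * a) - int n * b * ((2 * a) ^ m * b)] (mod int p)"
      using uv(2,3) by (intro cong_diff cong_mult cong_refl)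
    also have "a * ((2 * a) ^ m * a) - int n * b * ((2 * a) ^ m * b)
        = (2 * a) ^ Suc m * a - (2 * a) ^ m * (a\<^sup>2 + int n * b\<^sup>2)"
      by (simp add: algebra_simps power2_eq_square)
    also have "[\<dots> = (2 * a) ^ Suc m * a] (mod int p)"
      unfolding norm_eq by (simp add: cong_iff_dvd_diff)
    finally show ?thesis .
  qed
  moreover have "[a * v + b * u = (2 * a) ^ Suc m * b] (mod int p)"
  proof -
    have "[a * v + b * u = a * ((2 * a) ^ m * b) + b * ((2 * a) ^ m * a)] (mod int p)"
      using uv(2,3) by (intro cong_add cong_mult cong_refl)
    thus ?thesis by (simp add: algebra_simps)
  qed
  ultimately show ?case by blast
qed

lemma quad_power_neq_cnj_power:
  assumes "m > 0" and e: "e \<in> {1, - 1}"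
  shows "quad_elt n a b ^ m \<noteq> e * cnj (quad_elt n a b) ^ m"
proof
  assume eq: "quad_elt n a b ^ m = e * cnj (quad_elt n a b) ^ m"
  obtain u v where uv: "quad_elt n a b ^ m = quad_elt n u v"
      "[u = (2 * a) ^ (m - 1) * a] (mod int p)" "[v = (2 * a) ^ (m - 1) * b] (mod int p)"
    using quad_power_coordinates[of "m - 1"] \<open>m > 0\<close> by auto
  have "\<not> int p dvd (2 * a) ^ (m - 1)"
    using not_dvd_2 not_dvd_a prime_int_p by (metis prime_dvd_mult_iff prime_dvd_power)
  hence "\<not> int p dvd u" "\<not> int p dvd v"
    using cong_dvd_iff[OF cong_refl] not_dvd_a not_dvd_b prime_int_p
      uv(2,3)[THEN cong_dvd_iff] by (simp_all add: prime_dvd_mult_iff)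
  hence "u \<noteq> 0" "v \<noteq> 0" by auto
  moreover have "cnj (quad_elt n a b) ^ m = quad_elt n u (- v)"
    by (metis complex_cnj_power uv(1) cnj_quad_elt)
  hence "quad_elt n u v = e * quad_elt n u (- v)" using eq by (simp only: uv(1))
  ultimately show False using e n_ge_2 by (auto simp: complex_eq_iff)
qed

lemma quad_elt_nonzero: "quad_elt n a b \<noteq> 0"
  using b_nonzero n_ge_2 by (auto simp: complex_eq_iff)

lemma prime_power_products_eqD:
  assumes eq: "e * quad_elt n a b ^ i * cnj (quad_elt n a b) ^ (k - i) =
               e' * quad_elt n a b ^ j * cnj (quad_elt n a b) ^ (k - j)"
    and e: "e \<in> {1, - 1}" "e' \<in> {1, - 1}" and le: "i \<le> j" "j \<le> k"
  shows "e = e' \<and> i = j"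
proof -
  let ?P = "quad_elt n a b" and ?Q = "cnj (quad_elt n a b)"
  have nz: "?P \<noteq> 0" "?Q \<noteq> 0" using quad_elt_nonzero by simp_all
  have i: "?Q ^ (k - i) = ?Q ^ (j - i) * ?Q ^ (k - j)"
    using le by (simp flip: power_add)
  have j: "?P ^ j = ?P ^ i * ?P ^ (j - i)"
    using le by (simp flip: power_add)
  have "(?P ^ i * ?Q ^ (k - j)) * (e * ?Q ^ (j - i)) = (?P ^ i * ?Q ^ (k - j)) * (e' * ?P ^ (j - i))"
    using eq unfolding i j by (simp add: mult_ac)
  hence *: "e * ?Q ^ (j - i) = e' * ?P ^ (j - i)" using nz by simp
  hence "e' * (e * ?Q ^ (j - i)) = e' * (e' * ?P ^ (j - i))" by simp
  hence "?P ^ (j - i) = (e' * e) * ?Q ^ (j - i)" using e by auto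
  moreover have "e' * e \<in> {1, - 1}" using e by auto
  ultimately have "i = j"
    using quad_power_neq_cnj_power[of "j - i" "e' * e"] le by (cases "i < j") auto
  with * show ?thesis by simp
qed

theorem card_prime_power_norm:
  "card {z \<in> quad_order n. (cmod z)\<^sup>2 = real (p ^ k)} = 2 * (k + 1)"
proof -
  define g where
    "g = (\<lambda>(e, i). e * quad_elt n a b ^ i * cnj (quad_elt n a b) ^ (k - i))"
  define A where "A = {1, - 1 :: complex} \<times> {..k}"
  have P: "quad_elt n a b \<in> quad_order n" by (auto simp: quad_order_iff)
  have norm_P: "(cmod (quad_elt n a b))\<^sup>2 = real p"
    by (simp add: cmod_quad_elt_power2_eq_iff norm_eq)
  have "g ` A = {z \<in> quad_order n. (cmod z)\<^sup>2 = real (p ^ k)}"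
  proof (intro equalityI subsetI)
    fix z assume "z \<in> g ` A"
    then obtain e i where e: "e \<in> {1, - 1}" and i: "i \<le> k"
        and z: "z = e * quad_elt n a b ^ i * cnj (quad_elt n a b) ^ (k - i)"
      by (auto simp: g_def A_def)
    have "e \<in> quad_order n" using e quad_order_one quad_order_uminus by auto
    hence "z \<in> quad_order n"
      unfolding z using P by (intro quad_order_mult quad_order_power quad_order_cnj)
    moreover have "cmod z = cmod (quad_elt n a b) ^ k"
      using e i by (auto simp: z norm_mult norm_power simp flip: power_add)
    hence "(cmod z)\<^sup>2 = ((cmod (quad_elt n a b))\<^sup>2) ^ k"
      by (simp add: mult.commute flip: power_mult)
    hence "(cmod z)\<^sup>2 = real (p ^ k)" by (simp add: norm_P)
    ultimately show "z \<in> {z \<in> quad_order n. (cmod z)\<^sup>2 = real (p ^ k)}" by simp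
  next
    fix z assume "z \<in> {z \<in> quad_order n. (cmod z)\<^sup>2 = real (p ^ k)}"
    then obtain e i where "e \<in> {1, - 1}" "i \<le> k"
        and "z = e * quad_elt n a b ^ i * cnj (quad_elt n a b) ^ (k - i)"
      using prime_power_norm_form[of z k] by blast
    hence "z = g (e, i)" "(e, i) \<in> A" by (simp_all add: g_def A_def)
    thus "z \<in> g ` A" by blast
  qed
  moreover have "inj_on g A"
  proof (rule inj_onI)
    fix s t assume "s \<in> A" "t \<in> A" and eq: "g s = g t"
    then obtain e i e' j where s: "s = (e, i)" and t: "t = (e', j)"
        and e: "e \<in> {1, - 1}" "e' \<in> {1, - 1}" and k: "i \<le> k" "j \<le> k"
      by (auto simp: A_def)
    from eq have eq': "e * quad_elt n a b ^ i * cnj (quad_elt n a b) ^ (k - i) =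
        e' * quad_elt n a b ^ j * cnj (quad_elt n a b) ^ (k - j)"
      by (simp add: g_def s t)
    show "s = t"
    proof (cases "i \<le> j")
      case True
      thus ?thesis using prime_power_products_eqD[OF eq' e] k by (simp add: s t)
    next
      case False
      thus ?thesis using prime_power_products_eqD[OF eq'[symmetric] e(2,1)] k by (simp add: s t)
    qed
  qed
  ultimately have "card {z \<in> quad_order n. (cmod z)\<^sup>2 = real (p ^ k)} = card A"
    by (metis card_image)
  also have "card A = 2 * (k + 1)" by (simp add: A_def card_cartesian_product)
  finally show ?thesis .
qed

end

section \<open>Split primes\<close>

lemma prime_dvd_quad_discriminant:
  assumes "prime p"
  shows "int p dvd quad_discriminant (quad_field p)"
proof -
  have "squarefree p" using assms by (simp add: squarefree_prime)
  hence "quad_radicand (quad_field p) = p"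
    using assms prime_gt_0_nat by (simp add: quad_radicand_quad_field squarefree_part_squarefree)
  thus ?thesis by (simp add: quad_discriminant_def Let_def)
qed

theorem theorem1p1:
  fixes n p k :: nat
  assumes "n > 0" and "n \<noteq> 1"
    and "prime p"
    and "\<exists>z \<in> quad_order n. (cmod z)\<^sup>2 = real p"
    and "if p = 2 then [quad_discriminant (quad_field n) = 1] (mod 8)
         else Legendre (quad_discriminant (quad_field n)) (int p) = 1"
    and "gcd p (conductor (quad_field n) (quad_order n)) = 1"
    and "k > 0"
  shows "card {z \<in> quad_order n. (cmod z)\<^sup>2 = real (p ^ k)} = 2 * (k + 1)"
proof -
  obtain a b where "(cmod (quad_elt n a b))\<^sup>2 = real p"
    using assms(4) by (auto simp: quad_order_iff)
  hence "a\<^sup>2 + int n * b\<^sup>2 = int p" by (simp only: cmod_quad_elt_power2_eq_iff)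
  then interpret norm_form_prime n p a b
    using assms(1-3) by unfold_locales auto
  have not_dvd_disc: "\<not> int p dvd quad_discriminant (quad_field n)"
  proof (cases "p = 2")
    case True
    hence "quad_discriminant (quad_field n) mod 8 = 1" using assms(5) by (simp add: cong_def)
    thus ?thesis unfolding True by presburger
  next
    case False
    thus ?thesis using assms(5) by (auto simp: Legendre_def cong_0_iff split: if_splits)
  qed
  have "\<not> p dvd n"
    using dvd_imp_eq prime_dvd_quad_discriminant[OF prime_p] not_dvd_disc by auto
  then interpret unramified_norm_form_prime n p a b by unfold_locales
  show ?thesis by (rule card_prime_power_norm)
qed

end
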